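(* Let $\mathbf{T}=(\beta_n)_{n\in\mathbb{N}}=23323223322323322\cdots$ be the Thue--Morse word over $\{2,3\}$ starting with $2$, i.e., the fixed point starting with $2$ of the morphism $\tau\colon 2\mapsto 23,\ 3\mapsto 32$, viewed as a Cantor real base. For every $r\in[0,1)$, if $d_6(r)=c_0c_1c_2\cdots$ is the greedy $6$-expansion of $r$, then the greedy $\mathbf{T}$-expansion of $r$ is \[ d_{\mathbf{T}}(r)=h_{\beta_0}(c_0)h_{\beta_1}(c_1)h_{\beta_2}(c_2)\cdots = h_2(c_0)h_3(c_1)h_3(c_2)h_2(c_3)\cdots .\]
   Context: A Cantor real base is a sequence $\mathbf{B}=(\beta_n)_{n\in\mathbb{N}}$ of reals $>1$ with $\prod_n\beta_n=+\infty$. For $r\in[0,1]$, the greedy $\mathbf{B}$-expansion $d_{\mathbf{B}}(r)=(a_n)_{n\in\mathbb{N}}$ is defined by: having chosen $a_0,\ldots,a_{N-1}$, the digit $a_N$ is the largest integer such that $\sum_{n=0}^N a_n/(\beta_0\cdots\beta_n)\le r$. For a constant base $\beta$ this is the usual greedy $\beta$-expansion $d_\beta(r)$. The morphisms $h_2,h_3\colon\{0,\ldots,5\}^*\to\{0,1,2\}^*$ are defined as follows: writing $c=3a+b$ with $a\in\{0,1\}$, $b\in\{0,1,2\}$, set $h_2(c)=ab$; writing $c=2a+b$ with $a\in\{0,1,2\}$, $b\in\{0,1\}$, set $h_3(c)=ab$. Explicitly $h_2\colon 0\mapsto 00,1\mapsto 01,2\mapsto 02,3\mapsto 10,4\mapsto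 11,5\mapsto 12$ and $h_3\colon 0\mapsto 00,1\mapsto 01,2\mapsto 10,3\mapsto 11,4\mapsto 20,5\mapsto 21$.
   Formalization: The displayed prefix of T is wrong in its 17th letter (the fixed point of τ has 3 there, not 2); the theorem is stated for the fixed point of τ starting with 2. *)

theory Defs
  imports Complex_Main "HOL-Library.Stream"
begin

definition cantor_real_base :: "real stream \<Rightarrow> bool" where
  "cantor_real_base B \<longleftrightarrow>
     (\<forall>n. B !! n > 1) \<and> filterlim (\<lambda>N. \<Prod>n<N. B !! n) at_top sequentially"

function greedy_digit :: "real stream \<Rightarrow> real \<Rightarrow> nat \<Rightarrow> int" where
  "greedy_digit B r N =
     (GREATEST a :: int.
        (\<Sum>n<N. of_int (greedy_digit B r n) / (\<Prod>i\<le>n. B !! i))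
          + of_int a / (\<Prod>i\<le>N. B !! i) \<le> r)"
  by pat_completeness auto
termination
  by (relation "measure (\<lambda>(B, r, N). N)") auto

declare greedy_digit.simps [simp del]

definition greedy_expansion :: "real stream \<Rightarrow> real \<Rightarrow> int stream" where
  "greedy_expansion B r = smap (greedy_digit B r) nats"

lemma greedy_expansion_snth: "greedy_expansion B r !! n = greedy_digit B r n"
  by (simp add: greedy_expansion_def)

text \<open>Over a Cantor real base the greatest integer in the recursion exists, so the digits are
  determined by it.\<close>

lemma greedy_expansion_greatest:
  fixes r :: real
  assumes "cantor_real_base B"
  defines "d \<equiv> greedy_expansion B r"
  shows "(\<Sum>n\<le>N. of_int (d !! n) / (\<Prod>i\<le>n. B !! i)) \<le> r"
    and "(\<Sum>n<N. of_int (d !! n) / (\<Prod>i\<le>n. B !! i)) + of_int a / (\<Prod>i\<le>N. B !! i) \<le> r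
          \<Longrightarrow> a \<le> d !! N"
proof -
  define s where "s = (\<Sum>n<N. of_int (d !! n) / (\<Prod>i\<le>n. B !! i))"
  define p where "p = (\<Prod>i\<le>N. B !! i)"
  have "p > 0"
    using assms(1) unfolding p_def cantor_real_base_def
    by (intro prod_pos) (auto intro: less_trans[of 0 1])
  then have iff: "s + of_int a / p \<le> r \<longleftrightarrow> a \<le> \<lfloor>(r - s) * p\<rfloor>" for a :: int
    by (simp add: le_floor_iff field_simps)
  have "d !! N = (GREATEST a :: int. s + of_int a / p \<le> r)"
    unfolding d_def s_def p_def greedy_expansion_snth by (subst greedy_digit.simps) simp
  also have "\<dots> = \<lfloor>(r - s) * p\<rfloor>"
    unfolding iff by (rule Greatest_equality) auto
  finally have d: "d !! N = \<lfloor>(r - s) * p\<rfloor>" .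
  show "(\<Sum>n\<le>N. of_int (d !! n) / (\<Prod>i\<le>n. B !! i)) \<le> r"
    using iff[of "d !! N"] d by (simp add: s_def p_def lessThan_Suc_atMost[symmetric])
  show "a \<le> d !! N"
    if "(\<Sum>n<N. of_int (d !! n) / (\<Prod>i\<le>n. B !! i)) + of_int a / (\<Prod>i\<le>N. B !! i) \<le> r"
    using that iff[of a] d by (simp add: s_def p_def)
qed

text \<open>Morphisms are given by their letter images; \<open>flat (smap f w)\<close> is the image of the infinite
  word \<open>w\<close>.  The letters of the fixed point lie in \<open>{2, 3}\<close> (\<open>thue_morse_letters\<close>), so the value of
  \<open>tau\<close> elsewhere is irrelevant.\<close>

definition tau :: "nat \<Rightarrow> nat list" where
  "tau b = (if b = 2 then [2, 3] else [3, 2])"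

definition thue_morse :: "nat stream" where
  "thue_morse = (THE w. shd w = 2 \<and> flat (smap tau w) = w)"

lemma snth_flat_pairs:
  assumes "\<And>n. length (s !! n) = 2" and "j < 2"
  shows "flat s !! (2 * n + j) = s !! n ! j"
  using assms(1)
proof (induction n arbitrary: s)
  case (0 s)
  have l: "length (shd s) = 2" using 0[of 0] by simp
  then have "flat s = shd s @- flat (stl s)" by (intro flat_unfold) auto
  with l \<open>j < 2\<close> show ?case by (simp add: shift_snth_less)
next
  case (Suc n s)
  have l: "length (shd s) = 2" using Suc.prems[of 0] by simp
  then have "flat s = shd s @- flat (stl s)" by (intro flat_unfold) auto
  with l have "flat s !! (2 * Suc n + j) = flat (stl s) !! (2 * n + j)"
    using shift_snth_ge[of "shd s" "2 * Suc n + j" "flat (stl s)"] by (simp del: flat.simps)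
  also have "\<dots> = stl s !! n ! j"
    using Suc.prems[of "Suc m" for m] by (intro Suc.IH) simp
  finally show ?case by simp
qed

lemma fixed_point_tau_iff:
  "flat (smap tau w) = w \<longleftrightarrow> (\<forall>n. w !! (2 * n) = tau (w !! n) ! 0 \<and> w !! (2 * n + 1) = tau (w !! n) ! 1)"
  (is "?L \<longleftrightarrow> ?R")
proof -
  have f: "flat (smap tau w) !! (2 * n + j) = tau (w !! n) ! j" if "j < 2" for n j
    using snth_flat_pairs[of "smap tau w" j n] that by (simp add: tau_def)
  show ?thesis
  proof
    assume ?L then show ?R using f[of 0] f[of 1] by simp
  next
    assume R: ?R
    have "flat (smap tau w) !! m = w !! m" for m
    proof -
      have "m = 2 * (m div 2) + m mod 2" by simp
      moreover have "m mod 2 = 0 \<or> m mod 2 = 1" by auto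
      ultimately show ?thesis using R f[of 0 "m div 2"] f[of 1 "m div 2"]
        by (metis add.right_neutral one_less_numeral_iff semiring_norm(76) zero_less_numeral)
    qed
    then show ?L using smap_alt[of "\<lambda>x. x" "flat (smap tau w)" w] by (simp add: stream.map_ident)
  qed
qed

function tm_letter :: "nat \<Rightarrow> nat" where
  "tm_letter n = (if n = 0 then 2 else tau (tm_letter (n div 2)) ! (n mod 2))"
  by pat_completeness auto
termination by (relation "measure id") auto

declare tm_letter.simps [simp del]

lemma thue_morse_ex1: "\<exists>!w. shd w = 2 \<and> flat (smap tau w) = w"
proof (rule ex1I)
  have "tm_letter (2 * n) = tau (tm_letter n) ! 0" for n
    using tm_letter.simps[of "2 * n"] tm_letter.simps[of 0] by (cases "n = 0") (auto simp: tau_def)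
  moreover have "tm_letter (2 * n + 1) = tau (tm_letter n) ! 1" for n
    using tm_letter.simps[of "2 * n + 1"] by simp
  ultimately show "shd (smap tm_letter nats) = 2 \<and> flat (smap tau (smap tm_letter nats)) = smap tm_letter nats"
    unfolding fixed_point_tau_iff by (simp add: tm_letter.simps[of 0])
next
  fix w assume w: "shd w = 2 \<and> flat (smap tau w) = w"
  have "w !! n = tm_letter n" for n
  proof (induction n rule: less_induct)
    case (less n)
    show ?case
    proof (cases "n = 0")
      case True then show ?thesis using w by (simp add: tm_letter.simps)
    next
      case False
      then have "w !! (n div 2) = tm_letter (n div 2)" by (intro less) auto
      moreover have "n = 2 * (n div 2) + n mod 2" "n mod 2 = 0 \<or> n mod 2 = 1" by auto
      ultimately have "w !! n = tau (tm_letter (n div 2)) ! (n mod 2)"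
        using w unfolding fixed_point_tau_iff by (metis add.right_neutral)
      with False show ?thesis by (subst tm_letter.simps) simp
    qed
  qed
  then show "w = smap tm_letter nats" using smap_alt[of tm_letter nats w] by auto
qed

lemma thue_morse_fixed_point: "shd thue_morse = 2" "flat (smap tau thue_morse) = thue_morse"
  using theI'[OF thue_morse_ex1] by (simp_all add: thue_morse_def)

lemma thue_morse_snth:
  "thue_morse !! 0 = 2"
  "thue_morse !! (2 * n) = tau (thue_morse !! n) ! 0"
  "thue_morse !! (2 * n + 1) = tau (thue_morse !! n) ! 1"
  using thue_morse_fixed_point fixed_point_tau_iff[of thue_morse] by auto

lemma thue_morse_letters: "thue_morse !! n \<in> {2, 3}"
proof (cases "even n")
  case True
  then show ?thesis using thue_morse_snth(2)[of "n div 2"] by (simp add: tau_def split: if_splits)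
next
  case False
  then show ?thesis using thue_morse_snth(3)[of "n div 2"] by (auto simp: tau_def split: if_splits)
qed

lemma thue_morse_prefix:
  "stake 16 thue_morse = [2, 3, 3, 2, 3, 2, 2, 3, 3, 2, 2, 3, 2, 3, 3, 2]"
proof -
  note t = thue_morse_snth
  have 0: "thue_morse !! 0 = 2" by (rule t(1))
  have 1: "thue_morse !! 1 = 3" using t(3)[of 0] 0 by (simp add: tau_def)
  have 2: "thue_morse !! 2 = 3" "thue_morse !! 3 = 2"
    using t(2,3)[of 1] 1 by (simp_all add: tau_def)
  have 3: "thue_morse !! 4 = 3" "thue_morse !! 5 = 2" "thue_morse !! 6 = 2" "thue_morse !! 7 = 3"
    using t(2,3)[of 2] t(2,3)[of 3] 2 by (simp_all add: tau_def)
  have 4: "thue_morse !! 8 = 3" "thue_morse !! 9 = 2" "thue_morse !! 10 = 2" "thue_morse !! 11 = 3"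
    "thue_morse !! 12 = 2" "thue_morse !! 13 = 3" "thue_morse !! 14 = 3" "thue_morse !! 15 = 2"
    using t(2,3)[of 4] t(2,3)[of 5] t(2,3)[of 6] t(2,3)[of 7] 3 by (simp_all add: tau_def)
  have "stake 16 thue_morse = map ((!!) thue_morse) [0..<16]"
    by (rule nth_equalityI) auto
  also have "[0..<16] = [0, 1, 2, 3, 4, 5, 6, 7, 8, 9, 10, 11, 12, 13, 14, 15]"
    by (simp add: upt_rec)
  finally show ?thesis by (simp only: list.map 0 1 2 3 4)
qed

lemma cantor_real_base_if_ge_2:
  assumes "\<And>n. B !! n \<ge> 2"
  shows "cantor_real_base B"
proof -
  have "2 ^ N \<le> (\<Prod>n<N. B !! n)" for N
    using prod_mono[of "{..<N}" "\<lambda>_. 2 :: real" "\<lambda>n. B !! n"] assms by simp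
  moreover have "filterlim (\<lambda>N. 2 ^ N :: real) at_top sequentially"
    by (rule filterlim_at_infinity_imp_filterlim_at_top[OF filterlim_realpow_sequentially_gt1]) auto
  ultimately have "filterlim (\<lambda>N. \<Prod>n<N. B !! n) at_top sequentially"
    by (auto intro: filterlim_at_top_mono)
  moreover have "B !! n > 1" for n using assms[of n] by simp
  ultimately show ?thesis by (simp add: cantor_real_base_def)
qed

lemma cantor_real_base_thue_morse: "cantor_real_base (smap real thue_morse)"
proof (rule cantor_real_base_if_ge_2)
  show "smap real thue_morse !! n \<ge> 2" for n
    using thue_morse_letters[of n] by auto
qed

lemma cantor_real_base_6: "cantor_real_base (sconst 6)"
  by (rule cantor_real_base_if_ge_2) simp

definition h2 :: "int \<Rightarrow> int list" where
  "h2 c = [c div 3, c mod 3]"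

definition h3 :: "int \<Rightarrow> int list" where
  "h3 c = [c div 2, c mod 2]"

lemma h2_table:
  "h2 0 = [0,0]" "h2 1 = [0,1]" "h2 2 = [0,2]" "h2 3 = [1,0]" "h2 4 = [1,1]" "h2 5 = [1,2]"
  by (simp_all add: h2_def)

lemma h3_table:
  "h3 0 = [0,0]" "h3 1 = [0,1]" "h3 2 = [1,0]" "h3 3 = [1,1]" "h3 4 = [2,0]" "h3 5 = [2,1]"
  by (simp_all add: h3_def)

text \<open>Only \<open>b \<in> {2, 3}\<close> occurs.\<close>

definition h_morph :: "nat \<Rightarrow> int \<Rightarrow> int list" where
  "h_morph b = (if b = 2 then h2 else h3)"

end

theory Submission
  imports Defs
begin

text \<open>
  In an integer Cantor base \<open>B\<close>, write \<open>P\<^sub>N\<close> for the product of the first \<open>N\<close> entries.  The greedy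
  partial sum of length \<open>N\<close> of \<open>r \<in> [0, 1)\<close> is \<open>\<lfloor>r P\<^sub>N\<rfloor> / P\<^sub>N\<close>, so the digit of index \<open>N\<close> is the
  remainder of \<open>\<lfloor>r P\<^bsub>N+1\<^esub>\<rfloor>\<close> modulo \<open>B\<^sub>N\<close>.  In the Thue--Morse base each pair of entries
  \<open>\<beta>\<^bsub>2n\<^esub>, \<beta>\<^bsub>2n+1\<^esub>\<close> is \<open>2, 3\<close> or \<open>3, 2\<close>, according to \<open>\<beta>\<^sub>n\<close>, hence \<open>P\<^bsub>2n\<^esub> = 6\<^sup>n\<close>.  Both expansions are
  therefore read off the same integers \<open>\<lfloor>6\<^bsup>n+1\<^esup> r\<rfloor>\<close>, and \<open>h\<^sub>2\<close>, \<open>h\<^sub>3\<close> split a remainder modulo 6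
  into mixed-radix digits.
\<close>

text \<open>Clearing the positive denominator \<open>p\<close> turns the condition on
  \<open>a\<close> into \<open>a \<le> \<lfloor>(r - s) * p\<rfloor>\<close>, so the greatest such
  integer exists and is this floor.\<close>

lemma greedy_digit_floor:
  assumes "\<And>n. B !! n > 0"
  shows "greedy_digit B r N =
    \<lfloor>(r - (\<Sum>n<N. of_int (greedy_digit B r n) / (\<Prod>i\<le>n. B !! i))) * (\<Prod>i\<le>N. B !! i)\<rfloor>"
proof -
  define s where "s = (\<Sum>n<N. of_int (greedy_digit B r n) / (\<Prod>i\<le>n. B !! i))"
  define p where "p = (\<Prod>i\<le>N. B !! i)"
  have "p > 0"
    unfolding p_def by (intro prod_pos) (simp add: assms)
  then have iff: "s + of_int a / p \<le> r \<longleftrightarrow> a \<le> \<lfloor>(r - s) * p\<rfloor>" for a :: int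
    by (simp add: le_floor_iff field_simps)
  have "greedy_digit B r N = (GREATEST a :: int. s + of_int a / p \<le> r)"
    unfolding s_def p_def by (rule greedy_digit.simps)
  also have "\<dots> = \<lfloor>(r - s) * p\<rfloor>"
    unfolding iff by (rule Greatest_equality) auto
  finally show ?thesis
    by (simp add: s_def p_def)
qed

context
  fixes b :: "nat stream" and r :: real
  assumes b_pos: "\<And>n. b !! n > 0" and r: "r \<in> {0..<1}"
begin

private definition P :: "nat \<Rightarrow> nat" where
  "P N = (\<Prod>i<N. b !! i)"

private lemma P_pos: "P N > 0"
  unfolding P_def by (intro prod_pos) (simp add: b_pos)

private lemma P_Suc: "P (Suc N) = P N * b !! N"
  by (simp add: P_def)

private lemma prod_eq_P: "(\<Prod>i\<le>n. smap real b !! i) = real (P (Suc n))"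
  by (simp add: P_def lessThan_Suc_atMost[symmetric])

text \<open>\<open>P (Suc N) / P N\<close> is the integer \<open>b !! N\<close>, so the subtracted
  term can be pulled out of the floor. The assumption is the induction hypothesis of
  \<open>greedy_partial_sum\<close>, stated separately because the digit formula is needed both
  inside that induction and after it.\<close>

private lemma greedy_digit_from_partial_sum:
  assumes "(\<Sum>n<N. of_int (greedy_digit (smap real b) r n) / P (Suc n))
    = of_int \<lfloor>r * P N\<rfloor> / P N"
  shows "greedy_digit (smap real b) r N = \<lfloor>r * P (Suc N)\<rfloor> - int (b !! N) * \<lfloor>r * P N\<rfloor>"
proof -
  have "greedy_digit (smap real b) r N = \<lfloor>(r - of_int \<lfloor>r * P N\<rfloor> / P N) * P (Suc N)\<rfloor>"
    unfolding assms[symmetric] prod_eq_P[symmetric]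
    by (rule greedy_digit_floor) (simp add: b_pos)
  also have "(r - of_int \<lfloor>r * P N\<rfloor> / P N) * P (Suc N)
      = r * P (Suc N) - of_int (int (b !! N) * \<lfloor>r * P N\<rfloor>)"
    using P_pos[of N] by (simp add: P_Suc field_simps)
  finally show ?thesis
    by (simp only: floor_diff_of_int)
qed

private lemma greedy_partial_sum:
  "(\<Sum>n<N. of_int (greedy_digit (smap real b) r n) / P (Suc n))
    = of_int \<lfloor>r * P N\<rfloor> / P N"
proof (induction N)
  case 0
  \<comment> \<open>The empty sum must equal the integer part of \<open>r\<close>; this is where
    \<open>r < 1\<close> enters.\<close>
  have "\<lfloor>r\<rfloor> = 0" using r by (simp add: floor_eq_iff)
  then show ?case by (simp add: P_def)
next
  case (Suc N)
  have "(\<Sum>n<Suc N. of_int (greedy_digit (smap real b) r n) / P (Suc n))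
      = of_int \<lfloor>r * P N\<rfloor> / P N
        + of_int (\<lfloor>r * P (Suc N)\<rfloor> - int (b !! N) * \<lfloor>r * P N\<rfloor>) / P (Suc N)"
    by (simp only: sum.lessThan_Suc Suc.IH greedy_digit_from_partial_sum[OF Suc.IH])
  also have "\<dots> = of_int \<lfloor>r * P (Suc N)\<rfloor> / P (Suc N)"
    using P_pos[of N] b_pos[of N] by (simp add: P_Suc field_simps)
  finally show ?case .
qed

lemma greedy_digit_integer_base:
  "greedy_digit (smap real b) r N = \<lfloor>r * (\<Prod>i\<le>N. b !! i)\<rfloor> mod int (b !! N)"
proof -
  \<comment> \<open>Nested floors: dividing by an integer before or after taking the floor gives the
    same quotient, so the digit becomes a remainder.\<close>
  have "\<lfloor>r * P N\<rfloor> = \<lfloor>r * P (Suc N) / real_of_int (int (b !! N))\<rfloor>"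
    using b_pos[of N] by (simp add: P_Suc)
  also have "\<dots> = \<lfloor>r * P (Suc N)\<rfloor> div int (b !! N)"
    by (rule floor_divide_real_eq_div) simp
  finally have "greedy_digit (smap real b) r N = \<lfloor>r * P (Suc N)\<rfloor> mod int (b !! N)"
    using greedy_digit_from_partial_sum[OF greedy_partial_sum[of N]]
    by (simp add: minus_mult_div_eq_mod)
  then show ?thesis
    by (simp add: P_def lessThan_Suc_atMost)
qed

end

lemma prod_thue_morse_even: "(\<Prod>i<2 * n. thue_morse !! i) = 6 ^ n"
proof (induction n)
  case (Suc n)
  then show ?case
    using thue_morse_snth(2,3)[of n] by (simp add: tau_def)
qed simp

lemma greedy_digit_base_6:
  assumes "r \<in> {0..<1}"
  shows "greedy_digit (sconst 6) r n = \<lfloor>r * 6 ^ Suc n\<rfloor> mod 6"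
proof -
  have "smap real (sconst 6) = sconst 6"
    by (simp add: smap_alt)
  then show ?thesis
    using greedy_digit_integer_base[of "sconst 6" r n] assms by simp
qed

text \<open>At index \<open>2 * n\<close> the product is \<open>6 ^ Suc n\<close> divided by the
  other entry of the pair, so the floor is \<open>m\<close> divided by that entry; at
  \<open>2 * n + 1\<close> the pair is complete and the floor is \<open>m\<close> itself.\<close>

lemma greedy_digit_thue_morse:
  fixes n :: nat
  assumes "r \<in> {0..<1}"
  defines "m \<equiv> \<lfloor>r * 6 ^ Suc n\<rfloor>"
  shows "greedy_digit (smap real thue_morse) r (2 * n) = h_morph (thue_morse !! n) (m mod 6) ! 0"
    and "greedy_digit (smap real thue_morse) r (2 * n + 1) = h_morph (thue_morse !! n) (m mod 6) ! 1"
proof -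
  have pos: "thue_morse !! k > 0" for k
    using thue_morse_letters[of k] by auto
  note digit = greedy_digit_integer_base[OF pos assms(1)]
  note t = thue_morse_snth(2,3)[of n]
  have even: "(\<Prod>i\<le>2 * n. thue_morse !! i) = 6 ^ n * thue_morse !! (2 * n)"
    using prod_thue_morse_even[of n] by (simp add: lessThan_Suc_atMost[symmetric])
  have odd: "(\<Prod>i\<le>2 * n + 1. thue_morse !! i) = 6 ^ Suc n"
    using prod_thue_morse_even[of "Suc n"] by (simp add: lessThan_Suc_atMost[symmetric])
  have half: "\<lfloor>r * (6 ^ n * 3)\<rfloor> = m div 2"
    using floor_divide_real_eq_div[of 2 "r * 6 ^ Suc n"] by (simp add: m_def mult_ac)
  have third: "\<lfloor>r * (6 ^ n * 2)\<rfloor> = m div 3"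
    using floor_divide_real_eq_div[of 3 "r * 6 ^ Suc n"] by (simp add: m_def mult_ac)
  \<comment> \<open>Divide \<open>m mod 6 = 3 * (m div 3 mod 2) + m mod 3\<close> by 3;
    \<open>div2\<close> is the same with 2 and 3 exchanged.\<close>
  have div3: "m div 3 mod 2 = m mod 6 div 3"
    using zmod_zmult2_eq[of 2 m 3] by simp
  have div2: "m div 2 mod 3 = m mod 6 div 2"
    using zmod_zmult2_eq[of 3 m 2] by simp
  have mods: "m mod 3 = m mod 6 mod 3" "m mod 2 = m mod 6 mod 2"
    by (simp_all add: mod_mod_cancel)
  consider "thue_morse !! n = 2" | "thue_morse !! n = 3"
    using thue_morse_letters[of n] by auto
  then show "greedy_digit (smap real thue_morse) r (2 * n) = h_morph (thue_morse !! n) (m mod 6) ! 0"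
  proof cases
    case 1
    with t have "thue_morse !! (2 * n) = 2" by (simp add: tau_def)
    with 1 show ?thesis
      using third div3 by (simp add: digit even h_morph_def h2_def)
  next
    case 2
    with t have "thue_morse !! (2 * n) = 3" by (simp add: tau_def)
    with 2 show ?thesis
      using half div2 by (simp add: digit even h_morph_def h3_def)
  qed
  have "greedy_digit (smap real thue_morse) r (2 * n + 1) = m mod int (thue_morse !! (2 * n + 1))"
    unfolding digit odd m_def by simp
  then show "greedy_digit (smap real thue_morse) r (2 * n + 1)
      = h_morph (thue_morse !! n) (m mod 6) ! 1"
    using t thue_morse_letters[of n] mods by (auto simp: tau_def h_morph_def h2_def h3_def)
qed

lemma length_h_morph: "length (h_morph b x) = 2"
  by (simp add: h_morph_def h2_def h3_def)

lemma flat_smap2_h_morph_unfold: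
  "flat (smap2 h_morph s c) = h_morph (shd s) (shd c) @- flat (smap2 h_morph (stl s) (stl c))"
  using length_h_morph[of "shd s" "shd c"] by (subst flat_unfold) auto

lemma stream_eqI_pairs:
  assumes "\<And>n. s !! (2 * n) = t !! (2 * n)" and "\<And>n. s !! (2 * n + 1) = t !! (2 * n + 1)"
  shows "s = t"
proof -
  have "s !! n = t !! n" for n
    by (cases "even n") (use assms in \<open>auto elim!: evenE oddE\<close>)
  then show ?thesis
    using smap_alt[of "\<lambda>x. x" s t] by (simp add: stream.map_ident)
qed

theorem theorem2p2:
  fixes r :: real and c :: "int stream"
  assumes "r \<in> {0..<1}"
    and "greedy_expansion (sconst 6) r = c"
  shows "greedy_expansion (smap real thue_morse) r = flat (smap2 h_morph thue_morse c) \<and>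
    flat (smap2 h_morph thue_morse c) =
      h2 (c !! 0) @- h3 (c !! 1) @- h3 (c !! 2) @- h2 (c !! 3) @-
        flat (smap2 h_morph (sdrop 4 thue_morse) (sdrop 4 c))"
proof
  have c: "c !! n = \<lfloor>r * 6 ^ Suc n\<rfloor> mod 6" for n
    unfolding assms(2)[symmetric] greedy_expansion_snth by (rule greedy_digit_base_6[OF assms(1)])
  have flat: "flat (smap2 h_morph thue_morse c) !! (2 * n + j)
      = h_morph (thue_morse !! n) (c !! n) ! j" if "j < 2" for n j
    using snth_flat_pairs[of "smap2 h_morph thue_morse c" j n] that by (simp add: length_h_morph)
  show "greedy_expansion (smap real thue_morse) r = flat (smap2 h_morph thue_morse c)"
  proof (rule stream_eqI_pairs)
    fix n
    show "greedy_expansion (smap real thue_morse) r !! (2 * n)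
        = flat (smap2 h_morph thue_morse c) !! (2 * n)"
      using greedy_digit_thue_morse(1)[OF assms(1), of n] flat[of 0 n] c[of n]
      by (simp add: greedy_expansion_snth)
    show "greedy_expansion (smap real thue_morse) r !! (2 * n + 1)
        = flat (smap2 h_morph thue_morse c) !! (2 * n + 1)"
      unfolding greedy_expansion_snth greedy_digit_thue_morse(2)[OF assms(1)]
      using flat[of 1 n] c[of n] by simp
  qed
  have tm: "thue_morse !! 0 = 2" "thue_morse !! 1 = 3" "thue_morse !! 2 = 3" "thue_morse !! 3 = 2"
    using thue_morse_snth(1) thue_morse_snth(3)[of 0] thue_morse_snth(2,3)[of 1]
    by (simp_all add: tau_def)
  have suc: "Suc 0 = 1" "Suc 1 = 2" "Suc 2 = 3" "Suc 3 = 4"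
    by simp_all
  have h: "h_morph 2 = h2" "h_morph 3 = h3"
    by (simp_all add: h_morph_def)
  have unfold: "flat (smap2 h_morph (sdrop k thue_morse) (sdrop k c))
      = h_morph (thue_morse !! k) (c !! k)
        @- flat (smap2 h_morph (sdrop (Suc k) thue_morse) (sdrop (Suc k) c))" for k
    by (subst flat_smap2_h_morph_unfold) simp
  show "flat (smap2 h_morph thue_morse c) =
      h2 (c !! 0) @- h3 (c !! 1) @- h3 (c !! 2) @- h2 (c !! 3) @-
        flat (smap2 h_morph (sdrop 4 thue_morse) (sdrop 4 c))"
    \<comment> \<open>Only fixed instances are used, since \<open>unfold\<close> with
      \<open>k\<close> free would rewrite its own right-hand side forever.\<close>
    using unfold[of 0, unfolded sdrop.simps(1)]
    by (simp only: unfold[of 1] unfold[of 2] unfold[of 3] suc tm h)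
qed

end
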